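(* Fix $\kappa>\max\{\delta,1,2-\alpha_1-\beta_1\}$. Let $f_0,g_0:\mathbb{N}\to[0,\infty)$ satisfy $m_\kappa\langle f_0\rangle<\infty$ and $m_\kappa\langle g_0\rangle<\infty$, and let $f$ and $g$ be the solutions of the discrete equation $\frac{\partial f}{\partial t}=O[f]$ with initial data $f_0$ and $g_0$ respectively. Then, for all $t\in[0,\infty)$, $$\|f(t)-g(t)\|_{\ell^1}\le e^{Ct}\,\|f_0-g_0\|_{\ell^1},$$ where the constant $C>0$ depends only on $\max\{m_1\langle f_0\rangle,m_1\langle g_0\rangle\}$ and $\max\{m_\kappa\langle f_0\rangle,m_\kappa\langle g_0\rangle\}$ (the parameters $h,\alpha_n,\beta_n,\delta,\kappa$ being fixed).
   Context: $\mathbb{N}=\{1,2,3,\dots\}$. Fix a mesh size $h>0$ and positive real parameters $\alpha_n,\beta_n$ ($n\in\{1,2,3\}$) and $\delta$ with $\delta>\max_{n\in\{1,2,3\}}(\alpha_n+\beta_n)$ and $\delta>2\alpha_1+\beta_1-1$. For $x,y\ge 0$ let $K_n(x,y)=x^{\alpha_n}y^{\alpha_n}(x+y)^{\beta_n}$ and $\gamma(x)=x^\delta$. For $f:\mathbb{N}\to\mathbb{R}$ and $i\in\mathbb{N}$ set $$S^{(1)}_i[f]=\sum_{j=1}^{i-1}K_1(jh,(i-j)h)f_jf_{i-j}-2\sum_{j=1}^\infty K_1(ih,jh)f_if_j,$$ and for $n\in\{2,3\}$ $$S^{(n)}_i[f]=-\sum_{j=1}^{i-1}K_n((i-j)h,jh)f_if_j+\sum_{j=i+1}^\infty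 K_n((j-i)h,ih)f_if_j+\sum_{j=i+1}^\infty K_n(ih,(j-i)h)f_jf_{j-i},$$ $V_i[f]=\gamma(ih)f_i$, $S[f]=S^{(1)}[f]+S^{(2)}[f]+S^{(3)}[f]$, and $O[f]=S[f]-V[f]$. The moments are $m_k\langle f\rangle=\sum_{i=1}^\infty f_i\,(ih)^k$, $k\ge 0$. For $k>\max\{1,2-\alpha_1-\beta_1\}$ and $x\ge0$ define $$\mathcal{B}_k(x)=\Bigl(2\,\mathcal{C}_k\,x^{1+\frac{\delta+k-1}{\delta-2\alpha_1-\beta_1+1}+\frac{\delta}{k-1}}\Bigr)^{\frac{k-1}{\delta+k-1}},$$ where $\mathcal{C}_k$ is the positive constant $$\mathcal{C}_k=\frac{\delta-2\alpha_1-\beta_1+1}{\delta+k-1}\bigl[2^{\beta_1+1}(2^k-2)\bigr]^{\frac{\delta+k-1}{\delta-2\alpha_1-\beta_1+1}}\Bigl(\frac{2(2\alpha_1+\beta_1+k-2)}{\delta+k-1}\Bigr)^{\frac{2\alpha_1+\beta_1+k-2}{\delta-2\alpha_1-\beta_1+1}}.$$ "The solution" with initial datum $f_0$ means the global classical solution $f\in C^1([0,\infty);\ell^1(\mathbb{N}))$ of $\frac{\partial f}{\partial t}=O[f]$, $f(0)=f_0$, which for all $t\ge0$ satisfies $f(t,i)\ge0$, $m_1\langle f(t)\rangle\le m_1\langle f_0\rangle$ and $m_\kappa\langle f(t)\rangle\le\max\{m_\kappa\langle f_0\rangle,2\mathcal{B}_\kappa(m_1\langle f_0\rangle)\}$ (the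 paper's well-posedness theorem gives existence and uniqueness). *)

theory Defs
  imports "HOL-Analysis.Analysis"
begin

text \<open>
  Sequences are indexed by $\{1,2,3,\dots\}$. They are functions on \<^typ>\<open>nat\<close> whose value at
  \<open>0\<close> is never used. In the space \<open>ell1\<close> of absolutely summable sequences, that value is
  normalised to \<open>0\<close> so that equality in the type is equality on the positive indices.
\<close>

definition ell1_norm :: "(nat \<Rightarrow> real) \<Rightarrow> real"
  where "ell1_norm a = (\<Sum>\<^sub>\<infinity>i\<in>{1..}. \<bar>a i\<bar>)"

typedef ell1 = "{a :: nat \<Rightarrow> real. a 0 = 0 \<and> (\<lambda>i. \<bar>a i\<bar>) summable_on {1..}}"
  morphisms coord Abs_ell1
  by (rule exI[of _ "\<lambda>_. 0"]) auto

setup_lifting type_definition_ell1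

lemma ell1_abs_summable_add:
  fixes a b :: "nat \<Rightarrow> real"
  assumes "(\<lambda>i. \<bar>a i\<bar>) summable_on A" "(\<lambda>i. \<bar>b i\<bar>) summable_on A"
  shows "(\<lambda>i. \<bar>a i + b i\<bar>) summable_on A"
  by (rule summable_on_comparison_test[OF summable_on_add[OF assms]])
    (auto intro: abs_triangle_ineq)

lemma ell1_abs_summable_diff:
  fixes a b :: "nat \<Rightarrow> real"
  assumes "(\<lambda>i. \<bar>a i\<bar>) summable_on A" "(\<lambda>i. \<bar>b i\<bar>) summable_on A"
  shows "(\<lambda>i. \<bar>a i - b i\<bar>) summable_on A"
  using ell1_abs_summable_add[of a A "\<lambda>i. - b i"] assms by simp

instantiation ell1 :: real_vector
begin

lift_definition zero_ell1 :: ell1 is "\<lambda>_. 0" by simp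

lift_definition plus_ell1 :: "ell1 \<Rightarrow> ell1 \<Rightarrow> ell1" is "\<lambda>a b i. a i + b i"
  by (auto intro: ell1_abs_summable_add)

lift_definition minus_ell1 :: "ell1 \<Rightarrow> ell1 \<Rightarrow> ell1" is "\<lambda>a b i. a i - b i"
  by (auto intro: ell1_abs_summable_diff)

lift_definition uminus_ell1 :: "ell1 \<Rightarrow> ell1" is "\<lambda>a i. - a i" by simp

lift_definition scaleR_ell1 :: "real \<Rightarrow> ell1 \<Rightarrow> ell1" is "\<lambda>r a i. r * a i"
  by (auto simp: abs_mult intro: summable_on_cmult_right)

instance
  by standard (transfer; simp add: fun_eq_iff algebra_simps)+

end

instantiation ell1 :: real_normed_vector
begin

lift_definition norm_ell1 :: "ell1 \<Rightarrow> real" is ell1_norm .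

definition sgn_ell1 :: "ell1 \<Rightarrow> ell1"
  where "sgn_ell1 a = a /\<^sub>R norm a"

definition dist_ell1 :: "ell1 \<Rightarrow> ell1 \<Rightarrow> real"
  where "dist_ell1 a b = norm (a - b)"

definition uniformity_ell1 :: "(ell1 \<times> ell1) filter"
  where "uniformity_ell1 = (INF e\<in>{0<..}. principal {(a, b). dist a b < e})"

definition open_ell1 :: "ell1 set \<Rightarrow> bool"
  where "open_ell1 U \<longleftrightarrow> (\<forall>a\<in>U. eventually (\<lambda>(a', b). a' = a \<longrightarrow> b \<in> U) uniformity)"

instance
proof
  fix a b :: ell1 and r :: real
  show "dist a b = norm (a - b)" by (rule dist_ell1_def)
  show "sgn a = a /\<^sub>R norm a" by (rule sgn_ell1_def)
  show "(norm a = 0) = (a = 0)"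
  proof transfer
    fix a :: "nat \<Rightarrow> real"
    assume a: "a 0 = 0 \<and> (\<lambda>i. \<bar>a i\<bar>) summable_on {1..}"
    show "(ell1_norm a = 0) = (a = (\<lambda>_. 0))"
    proof
      assume "ell1_norm a = 0"
      then have "\<bar>a i\<bar> = 0" if "i \<ge> 1" for i
        using nonneg_infsum_le_0D[of "\<lambda>i. \<bar>a i\<bar>" "{1..}" i] a that
        by (simp add: ell1_norm_def)
      then show "a = (\<lambda>_. 0)"
        using a by (metis abs_eq_0 ext less_one not_le)
    qed (simp add: ell1_norm_def)
  qed
  show "norm (a + b) \<le> norm a + norm b"
  proof transfer
    fix a b :: "nat \<Rightarrow> real"
    assume a: "a 0 = 0 \<and> (\<lambda>i. \<bar>a i\<bar>) summable_on {1..}"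
      and b: "b 0 = 0 \<and> (\<lambda>i. \<bar>b i\<bar>) summable_on {1..}"
    have "(\<Sum>\<^sub>\<infinity>i\<in>{1..}. \<bar>a i + b i\<bar>) \<le> (\<Sum>\<^sub>\<infinity>i\<in>{1..}. \<bar>a i\<bar> + \<bar>b i\<bar>)"
      using a b by (intro infsum_mono ell1_abs_summable_add summable_on_add) auto
    also have "\<dots> = (\<Sum>\<^sub>\<infinity>i\<in>{1..}. \<bar>a i\<bar>) + (\<Sum>\<^sub>\<infinity>i\<in>{1..}. \<bar>b i\<bar>)"
      using a b by (intro infsum_add) auto
    finally show "ell1_norm (\<lambda>i. a i + b i) \<le> ell1_norm a + ell1_norm b"
      by (simp add: ell1_norm_def)
  qed
  show "norm (r *\<^sub>R a) = \<bar>r\<bar> * norm a"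
    by transfer (simp add: ell1_norm_def abs_mult infsum_cmult_right')
qed (simp_all add: uniformity_ell1_def open_ell1_def)

end

text \<open>
  The mesh size is \<open>h\<close>. The kernel exponents are given by \<open>\<alpha>\<close> and \<open>\<beta>\<close>, which are used only at
  the indices \<open>1\<close>, \<open>2\<close>, \<open>3\<close>.
\<close>

definition kern :: "(nat \<Rightarrow> real) \<Rightarrow> (nat \<Rightarrow> real) \<Rightarrow> nat \<Rightarrow> real \<Rightarrow> real \<Rightarrow> real"
  where "kern \<alpha> \<beta> n x y = x powr \<alpha> n * y powr \<alpha> n * (x + y) powr \<beta> n"

definition S_one ::
    "real \<Rightarrow> (nat \<Rightarrow> real) \<Rightarrow> (nat \<Rightarrow> real) \<Rightarrow> (nat \<Rightarrow> real) \<Rightarrow> nat \<Rightarrow> real"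
  where "S_one h \<alpha> \<beta> f i =
    (\<Sum>j\<in>{1..<i}. kern \<alpha> \<beta> 1 (real j * h) (real (i - j) * h) * f j * f (i - j))
    - 2 * (\<Sum>\<^sub>\<infinity>j\<in>{1..}. kern \<alpha> \<beta> 1 (real i * h) (real j * h) * f i * f j)"

definition S_ex ::
    "real \<Rightarrow> (nat \<Rightarrow> real) \<Rightarrow> (nat \<Rightarrow> real) \<Rightarrow> nat \<Rightarrow> (nat \<Rightarrow> real) \<Rightarrow> nat \<Rightarrow> real"
  where "S_ex h \<alpha> \<beta> n f i =
    - (\<Sum>j\<in>{1..<i}. kern \<alpha> \<beta> n (real (i - j) * h) (real j * h) * f i * f j)
    + (\<Sum>\<^sub>\<infinity>j\<in>{i + 1..}. kern \<alpha> \<beta> n (real (j - i) * h) (real i * h) * f i * f j)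
    + (\<Sum>\<^sub>\<infinity>j\<in>{i + 1..}. kern \<alpha> \<beta> n (real i * h) (real (j - i) * h) * f j * f (j - i))"

definition V_op :: "real \<Rightarrow> real \<Rightarrow> (nat \<Rightarrow> real) \<Rightarrow> nat \<Rightarrow> real"
  where "V_op h \<delta> f i = (real i * h) powr \<delta> * f i"

definition O_op ::
    "real \<Rightarrow> (nat \<Rightarrow> real) \<Rightarrow> (nat \<Rightarrow> real) \<Rightarrow> real \<Rightarrow> (nat \<Rightarrow> real) \<Rightarrow> nat \<Rightarrow> real"
  where "O_op h \<alpha> \<beta> \<delta> f i =
    S_one h \<alpha> \<beta> f i + S_ex h \<alpha> \<beta> 2 f i + S_ex h \<alpha> \<beta> 3 f i - V_op h \<delta> f i"

text \<open>
  \<open>moment\<close> has the default value \<open>0\<close> when the sum diverges, so bounds on it are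
  always accompanied by \<open>finite_moment\<close>.
\<close>

definition moment :: "real \<Rightarrow> real \<Rightarrow> (nat \<Rightarrow> real) \<Rightarrow> real"
  where "moment h k f = (\<Sum>\<^sub>\<infinity>i\<in>{1..}. f i * (real i * h) powr k)"

definition finite_moment :: "real \<Rightarrow> real \<Rightarrow> (nat \<Rightarrow> real) \<Rightarrow> bool"
  where "finite_moment h k f \<longleftrightarrow> (\<lambda>i. f i * (real i * h) powr k) summable_on {1..}"

definition C_const :: "(nat \<Rightarrow> real) \<Rightarrow> (nat \<Rightarrow> real) \<Rightarrow> real \<Rightarrow> real \<Rightarrow> real"
  where "C_const \<alpha> \<beta> \<delta> k =
    (\<delta> - 2 * \<alpha> 1 - \<beta> 1 + 1) / (\<delta> + k - 1)
    * (2 powr (\<beta> 1 + 1) * (2 powr k - 2)) powr ((\<delta> + k - 1) / (\<delta> - 2 * \<alpha> 1 - \<beta> 1 + 1))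
    * (2 * (2 * \<alpha> 1 + \<beta> 1 + k - 2) / (\<delta> + k - 1))
        powr ((2 * \<alpha> 1 + \<beta> 1 + k - 2) / (\<delta> - 2 * \<alpha> 1 - \<beta> 1 + 1))"

definition B_bound :: "(nat \<Rightarrow> real) \<Rightarrow> (nat \<Rightarrow> real) \<Rightarrow> real \<Rightarrow> real \<Rightarrow> real \<Rightarrow> real"
  where "B_bound \<alpha> \<beta> \<delta> k x =
    (2 * C_const \<alpha> \<beta> \<delta> k
      * x powr (1 + (\<delta> + k - 1) / (\<delta> - 2 * \<alpha> 1 - \<beta> 1 + 1) + \<delta> / (k - 1)))
    powr ((k - 1) / (\<delta> + k - 1))"

text \<open>
  Global classical solutions: \<open>F\<close> is the derivative of \<open>f\<close> in the norm of \<open>ell1\<close> (one-sided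
  at time \<open>0\<close>), so its continuity says that \<open>f\<close> is continuously differentiable.
\<close>

definition is_solution ::
    "real \<Rightarrow> (nat \<Rightarrow> real) \<Rightarrow> (nat \<Rightarrow> real) \<Rightarrow> real \<Rightarrow> real \<Rightarrow> (nat \<Rightarrow> real) \<Rightarrow> (real \<Rightarrow> ell1) \<Rightarrow> bool"
  where "is_solution h \<alpha> \<beta> \<delta> \<kappa> f0 f \<longleftrightarrow>
    (\<exists>F. continuous_on {0..} F \<and>
      (\<forall>t\<ge>0. (f has_vector_derivative F t) (at t within {0..}) \<and>
              (\<forall>i\<ge>1. coord (F t) i = O_op h \<alpha> \<beta> \<delta> (coord (f t)) i))) \<and>
    (\<forall>i\<ge>1. coord (f 0) i = f0 i) \<and>
    (\<forall>t\<ge>0.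
      (\<forall>i\<ge>1. 0 \<le> coord (f t) i) \<and>
      finite_moment h 1 (coord (f t)) \<and>
      moment h 1 (coord (f t)) \<le> moment h 1 f0 \<and>
      finite_moment h \<kappa> (coord (f t)) \<and>
      moment h \<kappa> (coord (f t)) \<le> max (moment h \<kappa> f0) (2 * B_bound \<alpha> \<beta> \<delta> \<kappa> (moment h 1 f0)))"

end

theory Submission
  imports Defs
begin

text \<open>
  Put \<open>w = f - g\<close>, \<open>x\<^sub>i = i h\<close> and let \<open>s\<close> be the largest \<open>\<alpha>\<^sub>n + \<beta>\<^sub>n\<close>. Since \<open>x\<^sub>i \<ge> h\<close>, every kernel
  satisfies \<open>K\<^sub>n(x\<^sub>i, x\<^sub>j) \<le> D x\<^sub>i\<^sup>s x\<^sub>j\<^sup>s\<close>, so the quadratic operator obeys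
  \<open>\<parallel>S[f] - S[g]\<parallel> \<le> 9 D (\<Sum> x\<^sub>i\<^sup>s \<bar>w\<^sub>i\<bar>) (\<Sum> x\<^sub>i\<^sup>s (f\<^sub>i + g\<^sub>i))\<close>. The last factor is controlled by the
  \<open>\<kappa>\<close>-moments, and because \<open>s < \<delta>\<close> the product is at most \<open>\<Sum> x\<^sub>i\<^sup>\<delta> \<bar>w\<^sub>i\<bar> + C \<parallel>w\<parallel>\<close>, whose first part is
  absorbed by the damping term \<open>V\<close>. This is used as the backward estimate
  \<open>\<parallel>w - \<epsilon> w'\<parallel> \<ge> (1 - \<epsilon> C) \<parallel>w\<parallel>\<close> for \<open>\<epsilon> \<ge> 0\<close>: with this sign the unbounded damping helps for
  every \<open>\<epsilon>\<close>, and neither the norm nor the infinite sums have to be differentiated.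
\<close>

section \<open>Sums over fibres and over products of index sets\<close>

lemma
  fixes f g :: "'a \<Rightarrow> real"
  assumes "f summable_on A" "g summable_on A"
  shows summable_on_diff: "(\<lambda>x. f x - g x) summable_on A"
    and infsum_diff: "(\<Sum>\<^sub>\<infinity>x\<in>A. f x - g x) = infsum f A - infsum g A"
  using summable_on_add[of f A "\<lambda>x. - g x"] infsum_add[of f A "\<lambda>x. - g x"] assms
  by (simp_all add: infsum_uminus summable_on_uminus)

text \<open>The pairs \<open>(p q, q)\<close> form the graph of \<open>p\<close>, which is in
  bijection with \<open>P\<close>. Summing over the graph first along each fibre groups the terms by
  the value of \<open>p\<close>; values without preimage contribute \<open>0\<close>.\<close>

lemma has_sum_fibers:
  fixes H :: "'a \<Rightarrow> real"
  assumes H: "H summable_on P" and p: "p ` P \<subseteq> A"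
  shows "((\<lambda>i. \<Sum>\<^sub>\<infinity>q\<in>{q\<in>P. p q = i}. H q) has_sum infsum H P) A"
proof (rule has_sum_SigmaD)
  have bij: "bij_betw snd (Sigma A (\<lambda>i. {q\<in>P. p q = i})) P"
    using p by (intro bij_betwI[where g = "\<lambda>q. (p q, q)"]) auto
  show "((\<lambda>x. H (snd x)) has_sum infsum H P) (Sigma A (\<lambda>i. {q\<in>P. p q = i}))"
    using has_sum_reindex_bij_betw[OF bij, of H] H by simp
  show "((\<lambda>q. H (snd (i, q))) has_sum (\<Sum>\<^sub>\<infinity>q\<in>{q\<in>P. p q = i}. H q)) {q\<in>P. p q = i}" for i
    using summable_on_subset_banach[OF H, of "{q\<in>P. p q = i}"] by simp
qed

text \<open>Tonelli: for nonnegative terms, convergence of the iterated sum already gives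
  summability over the product.\<close>

lemma has_sum_product_nonneg:
  fixes x :: "'a \<Rightarrow> real" and y :: "'b \<Rightarrow> real"
  assumes x: "x summable_on A" "\<And>a. a \<in> A \<Longrightarrow> 0 \<le> x a"
    and y: "y summable_on B" "\<And>b. b \<in> B \<Longrightarrow> 0 \<le> y b"
  shows "((\<lambda>q. x (fst q) * y (snd q)) has_sum infsum x A * infsum y B) (A \<times> B)"
proof -
  have *: "((\<lambda>b. x (fst (a, b)) * y (snd (a, b))) has_sum x a * infsum y B) B" for a
    using has_sum_cmult_right[of y B "infsum y B" "x a"] y(1) by simp
  have **: "((\<lambda>a. x a * infsum y B) has_sum infsum x A * infsum y B) A"
    using has_sum_cmult_left[of x A "infsum x A" "infsum y B"] x(1) by simp
  show ?thesis
    by (rule has_sum_SigmaI[OF * **])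
      (rule summable_on_SigmaI[OF * has_sum_imp_summable[OF **]], use x y in auto)
qed

section \<open>Difference estimate for quadratic forms over interacting pairs\<close>

text \<open>
  Every sum in the operator \<open>S\<close> has this form: \<open>P\<close> is the set of interacting pairs and \<open>p\<close> gives the
  size class whose balance the pair enters. Summing over all size classes is then a sum over \<open>P\<close>.
\<close>

definition fiber_form ::
    "(nat \<times> nat) set \<Rightarrow> (nat \<times> nat \<Rightarrow> nat) \<Rightarrow> (nat \<times> nat \<Rightarrow> real) \<Rightarrow> (nat \<Rightarrow> real) \<Rightarrow> nat \<Rightarrow> real"
  where "fiber_form P p k f i = (\<Sum>\<^sub>\<infinity>q\<in>{q\<in>P. p q = i}. k q * f (fst q) * f (snd q))"

lemma weighted_diff_summable:
  fixes u f g :: "nat \<Rightarrow> real"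
  assumes "\<And>i. i \<in> A \<Longrightarrow> 0 \<le> u i" "\<And>i. i \<in> A \<Longrightarrow> 0 \<le> f i" "\<And>i. i \<in> A \<Longrightarrow> 0 \<le> g i"
    and "(\<lambda>i. u i * f i) summable_on A" "(\<lambda>i. u i * g i) summable_on A"
  shows "(\<lambda>i. u i * (f i + g i)) summable_on A" "(\<lambda>i. u i * \<bar>f i - g i\<bar>) summable_on A"
proof -
  show *: "(\<lambda>i. u i * (f i + g i)) summable_on A"
    using summable_on_add[OF assms(4,5)] by (simp add: distrib_left)
  show "(\<lambda>i. u i * \<bar>f i - g i\<bar>) summable_on A"
  proof (rule summable_on_comparison_test[OF *])
    fix i assume "i \<in> A"
    then show "u i * \<bar>f i - g i\<bar> \<le> u i * (f i + g i)" "0 \<le> u i * \<bar>f i - g i\<bar>"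
      using assms(1-3)[of i] by (auto intro!: mult_left_mono)
  qed
qed

text \<open>Polarisation writes \<open>f a * f b - g a * g b\<close> as half of a symmetric
  combination of \<open>f - g\<close> at one index and \<open>f + g\<close> at the other. The kernel
  bound then splits the majorant into a product of two weighted sums. Regrouping by fibres does not
  increase the total, and enlarging \<open>P\<close> to all pairs only adds nonnegative terms, so
  the bound is the same for every \<open>P\<close> and \<open>p\<close>.\<close>

lemma fiber_form_diff:
  fixes u f g :: "nat \<Rightarrow> real"
  assumes P: "P \<subseteq> {1..} \<times> {1..}" and p: "p ` P \<subseteq> {1..}"
    and k: "\<And>q. q \<in> P \<Longrightarrow> 0 \<le> k q" "\<And>q. q \<in> P \<Longrightarrow> k q \<le> D * (u (fst q) * u (snd q))"
    and D: "0 \<le> D"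
    and u: "\<And>i. i \<ge> 1 \<Longrightarrow> 0 \<le> u i"
    and f: "\<And>i. i \<ge> 1 \<Longrightarrow> 0 \<le> f i" and g: "\<And>i. i \<ge> 1 \<Longrightarrow> 0 \<le> g i"
    and uf: "(\<lambda>i. u i * f i) summable_on {1..}" and ug: "(\<lambda>i. u i * g i) summable_on {1..}"
  shows "(\<lambda>i. \<bar>fiber_form P p k f i - fiber_form P p k g i\<bar>) summable_on {1..}" (is ?A)
    and "(\<Sum>\<^sub>\<infinity>i\<in>{1..}. \<bar>fiber_form P p k f i - fiber_form P p k g i\<bar>)
      \<le> D * ((\<Sum>\<^sub>\<infinity>i\<in>{1..}. u i * \<bar>f i - g i\<bar>) * (\<Sum>\<^sub>\<infinity>i\<in>{1..}. u i * (f i + g i)))" (is ?B)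
proof -
  define w where "w = (\<lambda>i. u i * \<bar>f i - g i\<bar>)"
  define s where "s = (\<lambda>i. u i * (f i + g i))"
  define W where "W = infsum w {1..}"
  define S where "S = infsum s {1..}"
  have ws: "s summable_on {1..}" "w summable_on {1..}"
    unfolding w_def s_def using weighted_diff_summable[of "{1..}" u f g] u f g uf ug by auto
  have ws0: "0 \<le> w i" "0 \<le> s i" if "i \<in> {1..}" for i
    using that u f g by (auto simp: w_def s_def)
  \<comment> \<open>Convergence is needed before subtracting: a divergent \<open>infsum\<close> has
    the default value \<open>0\<close>, and the two fibre sums could not be subtracted term by
    term.\<close>
  have ss: "(\<lambda>q. k q * e (fst q) * e (snd q)) summable_on P"
    if e: "\<And>i. i \<ge> 1 \<Longrightarrow> 0 \<le> e i" "(\<lambda>i. u i * e i) summable_on {1..}" for e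
  proof (rule summable_on_comparison_test)
    have "(\<lambda>q. (u (fst q) * e (fst q)) * (u (snd q) * e (snd q))) summable_on {1..} \<times> {1..}"
      using has_sum_product_nonneg[OF e(2) _ e(2)] u e(1) has_sum_imp_summable by fastforce
    then show "(\<lambda>q. D * ((u (fst q) * e (fst q)) * (u (snd q) * e (snd q)))) summable_on P"
      by (intro summable_on_cmult_right summable_on_subset_banach[OF _ P])
    fix q assume q: "q \<in> P"
    then have e': "0 \<le> e (fst q) * e (snd q)" using P e(1) by auto
    show "k q * e (fst q) * e (snd q) \<le> D * ((u (fst q) * e (fst q)) * (u (snd q) * e (snd q)))"
      using mult_right_mono[OF k(2)[OF q] e'] by (simp add: algebra_simps)
    show "0 \<le> k q * e (fst q) * e (snd q)"
      using mult_nonneg_nonneg[OF k(1)[OF q] e'] by (simp add: algebra_simps)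
  qed
  define H where "H = (\<lambda>q. k q * f (fst q) * f (snd q) - k q * g (fst q) * g (snd q))"
  \<comment> \<open>The factor \<open>1 / 2\<close> comes from the polarisation identity; each of
    the two halves sums to \<open>W * S\<close> over all pairs.\<close>
  define G where "G = (\<lambda>q. D / 2 * (w (fst q) * s (snd q) + s (fst q) * w (snd q)))"
  have "((\<lambda>q. w (fst q) * s (snd q)) has_sum W * S) ({1..} \<times> {1..})"
    "((\<lambda>q. s (fst q) * w (snd q)) has_sum S * W) ({1..} \<times> {1..})"
    unfolding W_def S_def using ws ws0 by (auto intro!: has_sum_product_nonneg)
  from has_sum_cmult_right[OF has_sum_add[OF this], of "D / 2"]
  have G: "(G has_sum D * (W * S)) ({1..} \<times> {1..})"
    by (simp add: G_def algebra_simps)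
  have G0: "0 \<le> G q" if "q \<in> {1..} \<times> {1..}" for q
    using that ws0 D by (auto simp: G_def)
  have HG: "\<bar>H q\<bar> \<le> G q" if q: "q \<in> P" for q
  proof -
    obtain a b where ab: "q = (a, b)" by force
    have ge: "a \<ge> 1" "b \<ge> 1" using q P ab by auto
    have eq: "f a * f b - g a * g b = ((f a - g a) * (f b + g b) + (f a + g a) * (f b - g b)) / 2"
      by (simp add: field_simps)
    have "\<bar>f a * f b - g a * g b\<bar>
        \<le> (\<bar>(f a - g a) * (f b + g b)\<bar> + \<bar>(f a + g a) * (f b - g b)\<bar>) / 2"
      unfolding eq by simp
    also have "\<dots> = (\<bar>f a - g a\<bar> * (f b + g b) + (f a + g a) * \<bar>f b - g b\<bar>) / 2" (is "_ = ?R")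
      using f g ge by (simp add: abs_mult)
    finally have le: "\<bar>f a * f b - g a * g b\<bar> \<le> ?R" .
    have "\<bar>H q\<bar> = k q * \<bar>f a * f b - g a * g b\<bar>"
      using k(1)[OF q] by (simp add: H_def ab abs_mult flip: right_diff_distrib mult.assoc)
        (simp add: mult.assoc abs_mult flip: right_diff_distrib)
    also have "\<dots> \<le> D * (u a * u b) * ?R"
      using k[OF q] le ab D u ge by (intro mult_mono) auto
    also have "\<dots> = G q"
      by (simp add: G_def w_def s_def ab algebra_simps)
    finally show ?thesis .
  qed
  have GP: "G summable_on P"
    using summable_on_subset_banach[OF has_sum_imp_summable[OF G] P] .
  have HP: "(\<lambda>q. \<bar>H q\<bar>) summable_on P"
    by (rule summable_on_comparison_test[OF GP]) (use HG in auto)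
  let ?F = "\<lambda>i. {q\<in>P. p q = i}"
  have d: "\<bar>fiber_form P p k f i - fiber_form P p k g i\<bar> \<le> (\<Sum>\<^sub>\<infinity>q\<in>?F i. \<bar>H q\<bar>)" for i
  proof -
    have "fiber_form P p k f i - fiber_form P p k g i = infsum H (?F i)"
      unfolding fiber_form_def H_def
      using ss[OF f uf] ss[OF g ug]
      by (subst infsum_diff) (auto intro: summable_on_subset_banach)
    then show ?thesis
      using norm_infsum_bound[of H "?F i"] summable_on_subset_banach[OF HP, of "?F i"] by auto
  qed
  note fib = has_sum_fibers[OF HP p]
  show A: ?A
    by (rule summable_on_comparison_test[OF has_sum_imp_summable[OF fib] d]) auto
  have "(\<Sum>\<^sub>\<infinity>i\<in>{1..}. \<bar>fiber_form P p k f i - fiber_form P p k g i\<bar>) \<le> (\<Sum>\<^sub>\<infinity>q\<in>P. \<bar>H q\<bar>)"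
    using infsum_mono[OF A has_sum_imp_summable[OF fib] d] infsumI[OF fib] by simp
  also have "\<dots> \<le> infsum G ({1..} \<times> {1..})"
    by (rule infsum_mono_neutral[OF HP has_sum_imp_summable[OF G]]) (use HG G0 P in auto)
  also have "\<dots> = D * (W * S)"
    by (rule infsumI[OF G])
  finally show ?B by (simp add: W_def S_def w_def s_def)
qed

section \<open>Exponential growth bound from a backward estimate\<close>

text \<open>
  The maximum of \<open>exp (- C' t) \<parallel>w t\<parallel>\<close> on \<open>[0, T]\<close> is attained at \<open>0\<close>: at a positive maximum point
  \<open>s\<close> the backward estimate would make the value at \<open>s - e\<close> larger.
\<close>

lemma norm_growth_bound:
  fixes w :: "real \<Rightarrow> 'a::real_normed_vector"
  assumes deriv: "\<And>t. t \<ge> 0 \<Longrightarrow> (w has_vector_derivative W t) (at t within {0..})"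
    and diss: "\<And>t e. t \<ge> 0 \<Longrightarrow> e \<ge> 0 \<Longrightarrow> norm (w t) * (1 - e * C) \<le> norm (w t - e *\<^sub>R W t)"
    and C: "0 \<le> C" "C < C'" and T: "0 \<le> T"
  shows "norm (w T) \<le> exp (C' * T) * norm (w 0)"
proof -
  define \<phi> where "\<phi> = (\<lambda>t. exp (- (C' * t)) * norm (w t))"
  have "continuous_on {0..} w"
    using deriv by (auto simp: continuous_on_eq_continuous_within
        intro: has_vector_derivative_continuous)
  then have "continuous_on {0..T} w" by (rule continuous_on_subset) auto
  then have "continuous_on {0..T} \<phi>"
    unfolding \<phi>_def by (intro continuous_intros)
  then obtain s where s: "s \<in> {0..T}" and max: "\<And>t. t \<in> {0..T} \<Longrightarrow> \<phi> t \<le> \<phi> s"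
    using continuous_attains_sup[of "{0..T}" \<phi>] T by auto
  have "\<phi> s \<le> \<phi> 0"
  proof (cases "s = 0 \<or> w s = 0")
    case True
    then show ?thesis by (auto simp: \<phi>_def)
  next
    case False
    then have s0: "s > 0" and N0: "norm (w s) > 0" using s by auto
    let ?N = "norm (w s)"
    \<comment> \<open>The midpoint leaves a gap on both sides: \<open>m - C\<close> pays for the
      remainder of the linearisation at \<open>s\<close>, and \<open>C' - m\<close> yields the
      contradiction.\<close>
    define m where "m = (C + C') / 2"
    have m: "m > 0" "C < m" "m < C'" using C by (auto simp: m_def)
    have "(m - C) * ?N > 0" using m N0 by simp
    then obtain d where d: "d > 0"
      and lin: "\<And>y. y \<ge> 0 \<Longrightarrow> \<bar>y - s\<bar> < d \<Longrightarrow>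
        norm (w y - w s - (y - s) *\<^sub>R W s) \<le> (m - C) * ?N * \<bar>y - s\<bar>"
      using deriv[of s] s0 unfolding has_vector_derivative_def has_derivative_within_alt
      by fastforce
    \<comment> \<open>The three bounds keep \<open>s - e\<close> nonnegative, keep it within the
      range \<open>d\<close> of the linearisation, and make the second-order term
      \<open>e * (m * C')\<close> smaller than \<open>C' - m\<close>.\<close>
    define e where "e = min (min s (d / 2)) ((C' - m) / (2 * (m * C')))"
    have e: "e > 0" "e \<le> s" "e < d" "e \<le> (C' - m) / (2 * (m * C'))"
      using s0 d m C by (auto simp: e_def)
    have em: "e * (m * C') < C' - m"
    proof -
      have "e * (m * C') \<le> (C' - m) / (2 * (m * C')) * (m * C')"
        using e(4) m C by (intro mult_right_mono) auto
      also have "\<dots> = (C' - m) / 2" using m C by simp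
      finally show ?thesis using m by simp
    qed
    let ?r = "w (s - e) - w s + e *\<^sub>R W s"
    have r: "norm ?r \<le> (m - C) * ?N * e"
      using lin[of "s - e"] e by simp
    have "?N * (1 - e * C) \<le> norm (w s - e *\<^sub>R W s)"
      using diss[of s e] s0 e by simp
    also have "w s - e *\<^sub>R W s = w (s - e) - ?r" by simp
    also have "norm (w (s - e) - ?r) \<le> norm (w (s - e)) + norm ?r"
      by (rule norm_triangle_ineq4)
    finally have "?N * (1 - e * m) \<le> norm (w (s - e))"
      using r by (simp add: algebra_simps)
    \<comment> \<open>Maximality of \<open>\<phi>\<close> at \<open>s\<close>, compared with the
      earlier time \<open>s - e\<close>.\<close>
    also have "norm (w (s - e)) \<le> exp (- (C' * e)) * ?N"
    proof -
      have "exp (- (C' * (s - e))) * norm (w (s - e)) \<le> exp (- (C' * s)) * ?N"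
        using max[of "s - e"] s e by (auto simp: \<phi>_def)
      then have "exp (C' * (s - e)) * (exp (- (C' * (s - e))) * norm (w (s - e)))
          \<le> exp (C' * (s - e)) * (exp (- (C' * s)) * ?N)"
        by simp
      then show ?thesis
        by (simp add: algebra_simps flip: exp_add mult.assoc)
    qed
    finally have "1 - e * m \<le> exp (- (C' * e))"
      using N0 by (simp add: mult.commute)
    \<comment> \<open>Since \<open>1 + C' * e\<close> is at most \<open>exp (C' * e)\<close>, the
      exponential disappears and only a quadratic inequality in \<open>e\<close> is left, which
      \<open>em\<close> contradicts.\<close>
    then have "(1 - e * m) * (1 + C' * e) \<le> exp (- (C' * e)) * (1 + C' * e)"
      using C e by (intro mult_right_mono) auto
    also have "\<dots> \<le> exp (- (C' * e)) * exp (C' * e)"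
      by (intro mult_left_mono) auto
    also have "\<dots> = 1" by (simp flip: exp_add)
    finally have "e * (C' - m) \<le> e * (e * (m * C'))"
      by (simp add: algebra_simps)
    with em e(1) show ?thesis by simp
  qed
  with max[of T] T have "\<phi> T \<le> \<phi> 0" by force
  then have "exp (C' * T) * \<phi> T \<le> exp (C' * T) * \<phi> 0" by simp
  then show ?thesis by (simp add: \<phi>_def flip: exp_add mult.assoc)
qed

section \<open>Calculus of norm bounds for plain sequences\<close>

text \<open>Summability is included because \<open>ell1_norm\<close> takes the default value
  \<open>0\<close> on a sequence that is not absolutely summable, where a norm bound alone would say
  nothing.\<close>

definition ell1_le :: "(nat \<Rightarrow> real) \<Rightarrow> real \<Rightarrow> bool"
  where "ell1_le d B \<longleftrightarrow> (\<lambda>i. \<bar>d i\<bar>) summable_on {1..} \<and> ell1_norm d \<le> B"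

lemma ell1_le_add:
  assumes "ell1_le c B" "ell1_le d B'"
  shows "ell1_le (\<lambda>i. c i + d i) (B + B')"
proof -
  have cd: "(\<lambda>i. \<bar>c i\<bar>) summable_on {1..}" "(\<lambda>i. \<bar>d i\<bar>) summable_on {1..}"
    using assms by (auto simp: ell1_le_def)
  have "(\<Sum>\<^sub>\<infinity>i\<in>{1..}. \<bar>c i + d i\<bar>) \<le> (\<Sum>\<^sub>\<infinity>i\<in>{1..}. \<bar>c i\<bar> + \<bar>d i\<bar>)"
    using cd by (intro infsum_mono ell1_abs_summable_add summable_on_add) auto
  also have "\<dots> = ell1_norm c + ell1_norm d"
    using cd by (simp add: infsum_add ell1_norm_def)
  finally show ?thesis
    using assms cd by (auto simp: ell1_le_def ell1_norm_def intro: ell1_abs_summable_add)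
qed

lemma ell1_le_cmult: "ell1_le d B \<Longrightarrow> ell1_le (\<lambda>i. r * d i) (\<bar>r\<bar> * B)"
  by (auto simp: ell1_le_def ell1_norm_def abs_mult infsum_cmult_right'
      intro: summable_on_cmult_right mult_left_mono)

lemma ell1_le_cong:
  assumes "ell1_le d B" "\<And>i. i \<ge> 1 \<Longrightarrow> c i = d i"
  shows "ell1_le c B"
proof -
  have "(\<lambda>i. \<bar>c i\<bar>) summable_on {1..} \<longleftrightarrow> (\<lambda>i. \<bar>d i\<bar>) summable_on {1..}"
    using assms(2) by (intro summable_on_cong) auto
  moreover have "ell1_norm c = ell1_norm d"
    unfolding ell1_norm_def using assms(2) by (intro infsum_cong) auto
  ultimately show ?thesis using assms(1) by (simp add: ell1_le_def)
qed

section \<open>The interaction sums as fibre forms\<close>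

text \<open>A pair \<open>(a, b)\<close> is a gain for the size \<open>a + b\<close> and a loss for
  the size \<open>a\<close>. The finite gain sum is read as an \<open>infsum\<close> so that it can
  be reindexed by \<open>j\<close> going to \<open>(j, i - j)\<close>.\<close>

lemma S_one_fiber_form:
  assumes "i \<ge> 1"
  shows "S_one h \<alpha> \<beta> f i
    = fiber_form ({1..} \<times> {1..}) (\<lambda>(a, b). a + b) (\<lambda>(a, b). kern \<alpha> \<beta> 1 (real a * h) (real b * h)) f i
      - 2 * fiber_form ({1..} \<times> {1..}) fst (\<lambda>(a, b). kern \<alpha> \<beta> 1 (real a * h) (real b * h)) f i"
proof -
  have "(\<Sum>j\<in>{1..<i}. kern \<alpha> \<beta> 1 (real j * h) (real (i - j) * h) * f j * f (i - j))
    = fiber_form ({1..} \<times> {1..}) (\<lambda>(a, b). a + b) (\<lambda>(a, b). kern \<alpha> \<beta> 1 (real a * h) (real b * h)) f i"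
    unfolding fiber_form_def infsum_finite[OF finite_atLeastLessThan, symmetric]
    by (rule infsum_reindex_bij_witness[where i = fst and j = "\<lambda>j. (j, i - j)"]) auto
  moreover have "(\<Sum>\<^sub>\<infinity>j\<in>{1..}. kern \<alpha> \<beta> 1 (real i * h) (real j * h) * f i * f j)
    = fiber_form ({1..} \<times> {1..}) fst (\<lambda>(a, b). kern \<alpha> \<beta> 1 (real a * h) (real b * h)) f i"
    unfolding fiber_form_def
    by (rule infsum_reindex_bij_witness[where i = snd and j = "Pair i"]) (use assms in auto)
  ultimately show ?thesis by (simp add: S_one_def)
qed

text \<open>The three sums are filed under the larger size, under the smaller size, and under the
  difference of the two. In the last one the pair is \<open>(j, j - i)\<close>, so the size that
  gains is \<open>i = a - b\<close>.\<close>

lemma S_ex_fiber_form: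
  assumes "i \<ge> 1"
  shows "S_ex h \<alpha> \<beta> n f i
    = - fiber_form {(a, b). 1 \<le> b \<and> b < a} fst
          (\<lambda>(a, b). kern \<alpha> \<beta> n (real (a - b) * h) (real b * h)) f i
      + fiber_form {(a, b). 1 \<le> a \<and> a < b} fst
          (\<lambda>(a, b). kern \<alpha> \<beta> n (real (b - a) * h) (real a * h)) f i
      + fiber_form {(a, b). 1 \<le> b \<and> b < a} (\<lambda>(a, b). a - b)
          (\<lambda>(a, b). kern \<alpha> \<beta> n (real (a - b) * h) (real b * h)) f i"
proof -
  have "(\<Sum>j\<in>{1..<i}. kern \<alpha> \<beta> n (real (i - j) * h) (real j * h) * f i * f j)
    = fiber_form {(a, b). 1 \<le> b \<and> b < a} fst
        (\<lambda>(a, b). kern \<alpha> \<beta> n (real (a - b) * h) (real b * h)) f i"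
    unfolding fiber_form_def infsum_finite[OF finite_atLeastLessThan, symmetric]
    by (rule infsum_reindex_bij_witness[where i = snd and j = "Pair i"]) auto
  moreover have "(\<Sum>\<^sub>\<infinity>j\<in>{i + 1..}. kern \<alpha> \<beta> n (real (j - i) * h) (real i * h) * f i * f j)
    = fiber_form {(a, b). 1 \<le> a \<and> a < b} fst
        (\<lambda>(a, b). kern \<alpha> \<beta> n (real (b - a) * h) (real a * h)) f i"
    unfolding fiber_form_def
    by (rule infsum_reindex_bij_witness[where i = snd and j = "Pair i"]) (use assms in auto)
  moreover have "(\<Sum>\<^sub>\<infinity>j\<in>{i + 1..}. kern \<alpha> \<beta> n (real i * h) (real (j - i) * h) * f j * f (j - i))
    = fiber_form {(a, b). 1 \<le> b \<and> b < a} (\<lambda>(a, b). a - b)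
        (\<lambda>(a, b). kern \<alpha> \<beta> n (real (a - b) * h) (real b * h)) f i"
    unfolding fiber_form_def
    by (rule infsum_reindex_bij_witness[where i = fst and j = "\<lambda>j. (j, j - i)"]) (use assms in auto)
  ultimately show ?thesis by (simp add: S_ex_def)
qed

section \<open>Estimates for kernels, powers and the moment bound\<close>

lemma kern_nonneg: "0 \<le> x \<Longrightarrow> 0 \<le> y \<Longrightarrow> 0 \<le> kern \<alpha> \<beta> n x y"
  by (simp add: kern_def)

text \<open>With nonnegative exponents, replacing \<open>x - y\<close> by \<open>x\<close> increases
  both its own power and the power of the sum. This brings the exchange kernels back to the sizes of
  the interacting pair.\<close>

lemma kern_diff_le:
  assumes "0 \<le> y" "y \<le> x" "0 \<le> \<alpha> n" "0 \<le> \<beta> n"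
  shows "kern \<alpha> \<beta> n (x - y) y \<le> kern \<alpha> \<beta> n x y"
  unfolding kern_def using assms by (intro mult_mono powr_mono2) auto

text \<open>The exponent \<open>a - b\<close> is not positive, so \<open>x powr (a - b)\<close> is
  largest at the mesh size \<open>h\<close>.\<close>

lemma powr_le_rescale:
  fixes h x :: real
  assumes "0 < h" "h \<le> x" "a \<le> b"
  shows "x powr a \<le> h powr (a - b) * x powr b"
proof -
  have "x powr a = x powr (a - b) * x powr b" using assms by (simp flip: powr_add)
  also have "\<dots> \<le> h powr (a - b) * x powr b"
    using assms by (intro mult_right_mono powr_mono2') auto
  finally show ?thesis .
qed

text \<open>Because \<open>x\<close> and \<open>y\<close> are at least \<open>h\<close>, the sum
  \<open>x + y\<close> is at most \<open>2 / h * (x * y)\<close>. The kernel thus separates into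
  equal powers of \<open>x\<close> and \<open>y\<close>, which are then raised from \<alpha> n +
  \<beta> n to the common exponent \<open>s\<close>.\<close>

lemma kern_le:
  assumes "0 < h" "h \<le> x" "h \<le> y" "0 \<le> \<alpha> n" "0 \<le> \<beta> n" "\<alpha> n + \<beta> n \<le> s"
  shows "kern \<alpha> \<beta> n x y
    \<le> (2 / h) powr \<beta> n * h powr (2 * (\<alpha> n + \<beta> n - s)) * (x powr s * y powr s)"
proof -
  have pos: "0 < x" "0 < y" using assms by auto
  have "h * x \<le> y * x" "h * y \<le> x * y" using assms by (auto intro: mult_right_mono)
  then have "x + y \<le> 2 / h * (x * y)"
    using assms(1) by (simp add: field_simps)
  then have "(x + y) powr \<beta> n \<le> (2 / h * (x * y)) powr \<beta> n"
    using pos assms by (intro powr_mono2) auto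
  also have "\<dots> = (2 / h) powr \<beta> n * (x powr \<beta> n * y powr \<beta> n)"
    using pos assms by (simp only: powr_mult[of "2 / h" "x * y"] powr_mult[of x y])
  finally have "kern \<alpha> \<beta> n x y
      \<le> x powr \<alpha> n * y powr \<alpha> n * ((2 / h) powr \<beta> n * (x powr \<beta> n * y powr \<beta> n))"
    unfolding kern_def by (intro mult_left_mono) auto
  also have "\<dots> = (2 / h) powr \<beta> n * (x powr (\<alpha> n + \<beta> n) * y powr (\<alpha> n + \<beta> n))"
    by (simp add: powr_add)
  also have "\<dots> \<le> (2 / h) powr \<beta> n
      * ((h powr (\<alpha> n + \<beta> n - s) * x powr s) * (h powr (\<alpha> n + \<beta> n - s) * y powr s))"
    using assms by (intro mult_left_mono mult_mono powr_le_rescale) auto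
  also have "\<dots> = (2 / h) powr \<beta> n * h powr (2 * (\<alpha> n + \<beta> n - s)) * (x powr s * y powr s)"
    unfolding mult_2 powr_add[of h] by (simp only: ac_simps)
  finally show ?thesis .
qed

text \<open>A Young-type inequality by cases. If \<open>y\<close> is at most
  \<open>x powr (\<delta> - s)\<close>, the product is below \<open>x powr \<delta>\<close>;
  otherwise \<open>x\<close> is below \<open>y powr (1 / (\<delta> - s))\<close>, and the exponents
  of \<open>y\<close> add up as
  \<open>1 + s / (\<delta> - s) = \<delta> / (\<delta> - s)\<close>.\<close>

lemma powr_absorb:
  fixes x y s \<delta> :: real
  assumes "0 \<le> x" "0 \<le> y" "0 < s" "s < \<delta>"
  shows "y * x powr s \<le> x powr \<delta> + y powr (\<delta> / (\<delta> - s))"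
proof (cases "y \<le> x powr (\<delta> - s)")
  case True
  then have "y * x powr s \<le> x powr (\<delta> - s) * x powr s" by (intro mult_right_mono) auto
  also have "\<dots> = x powr \<delta>" by (simp flip: powr_add)
  finally show ?thesis by (smt (verit) powr_ge_zero)
next
  case False
  have "x = (x powr (\<delta> - s)) powr (1 / (\<delta> - s))"
    using assms by (simp add: powr_powr)
  also have "\<dots> \<le> y powr (1 / (\<delta> - s))"
    using False assms by (intro powr_mono2) auto
  finally have "x powr s \<le> (y powr (1 / (\<delta> - s))) powr s"
    using assms by (intro powr_mono2) auto
  then have "y * x powr s \<le> y powr 1 * y powr (s / (\<delta> - s))"
    using assms by (intro mult_mono) (auto simp: powr_powr)
  also have "\<dots> = y powr (\<delta> / (\<delta> - s))"
    using assms by (simp only: flip: powr_add) (simp add: field_simps)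
  finally show ?thesis by (smt (verit) powr_ge_zero)
qed

text \<open>Allows the first moment of each initial datum to be replaced by the larger of the two,
  so that one constant serves both solutions.\<close>

lemma B_bound_mono:
  assumes "0 \<le> x" "x \<le> y" "1 < k" "0 < \<delta>" "2 * \<alpha> 1 + \<beta> 1 - 1 < \<delta>"
  shows "B_bound \<alpha> \<beta> \<delta> k x \<le> B_bound \<alpha> \<beta> \<delta> k y"
proof -
  define d where "d = \<delta> - 2 * \<alpha> 1 - \<beta> 1 + 1"
  have d: "0 < d" using assms by (simp add: d_def)
  have C: "0 \<le> C_const \<alpha> \<beta> \<delta> k"
    unfolding C_const_def d_def[symmetric] using assms d by simp
  have "0 \<le> (\<delta> + k - 1) / d" "0 \<le> \<delta> / (k - 1)" using assms d by simp_all
  then have "x powr (1 + (\<delta> + k - 1) / d + \<delta> / (k - 1)) \<le> y powr (1 + (\<delta> + k - 1) / d + \<delta> / (k - 1))"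
    using assms by (intro powr_mono2) auto
  then show ?thesis
    unfolding B_bound_def d_def[symmetric] using C assms
    by (intro powr_mono2[of "(k - 1) / (\<delta> + k - 1)"] mult_left_mono) auto
qed

section \<open>Absorption of the interaction by the damping\<close>

text \<open>The argument of the norm is \<open>(1 + e * v i) * w i - e * R i\<close>. The reverse
  triangle inequality bounds its modulus below by \<open>\<bar>w i\<bar> + e * v i * \<bar>w i\<bar>
  - e * \<bar>R i\<bar>\<close>. After summation, \<open>absorb\<close> lets the \<open>v\<close>
  part compensate \<open>R\<close> up to \<open>c * ell1_norm w\<close>. Every \<open>e\<close> of
  nonnegative sign is allowed, however large \<open>v\<close> becomes.\<close>

lemma dissipation:
  fixes w R u v :: "nat \<Rightarrow> real"
  assumes w: "(\<lambda>i. \<bar>w i\<bar>) summable_on {1..}" and uw: "(\<lambda>i. u i * \<bar>w i\<bar>) summable_on {1..}"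
    and vw: "(\<lambda>i. v i * \<bar>w i\<bar>) summable_on {1..}"
    and R: "ell1_le R (y * (\<Sum>\<^sub>\<infinity>i\<in>{1..}. u i * \<bar>w i\<bar>))"
    and absorb: "\<And>i. i \<ge> 1 \<Longrightarrow> y * u i \<le> v i + c"
    and v: "\<And>i. i \<ge> 1 \<Longrightarrow> 0 \<le> v i" and e: "0 \<le> e"
    and sum: "(\<lambda>i. \<bar>w i - e * (R i - v i * w i)\<bar>) summable_on {1..}"
  shows "ell1_norm w * (1 - e * c) \<le> ell1_norm (\<lambda>i. w i - e * (R i - v i * w i))"
proof -
  have Rs: "(\<lambda>i. \<bar>R i\<bar>) summable_on {1..}" using R by (simp add: ell1_le_def)
  have "ell1_norm R \<le> (\<Sum>\<^sub>\<infinity>i\<in>{1..}. y * (u i * \<bar>w i\<bar>))"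
    using R by (simp add: ell1_le_def infsum_cmult_right')
  also have "\<dots> \<le> (\<Sum>\<^sub>\<infinity>i\<in>{1..}. v i * \<bar>w i\<bar> + c * \<bar>w i\<bar>)"
  proof (intro infsum_mono summable_on_add summable_on_cmult_right uw vw w)
    fix i :: nat assume "i \<in> {1..}"
    then have "y * u i * \<bar>w i\<bar> \<le> (v i + c) * \<bar>w i\<bar>"
      using absorb by (intro mult_right_mono) auto
    then show "y * (u i * \<bar>w i\<bar>) \<le> v i * \<bar>w i\<bar> + c * \<bar>w i\<bar>" by (simp add: algebra_simps)
  qed
  also have "\<dots> = (\<Sum>\<^sub>\<infinity>i\<in>{1..}. v i * \<bar>w i\<bar>) + c * ell1_norm w"
    using vw w by (simp add: infsum_add summable_on_cmult_right infsum_cmult_right' ell1_norm_def)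
  finally have RV: "ell1_norm R - (\<Sum>\<^sub>\<infinity>i\<in>{1..}. v i * \<bar>w i\<bar>) \<le> c * ell1_norm w" by simp
  have "ell1_norm w * (1 - e * c) = ell1_norm w - e * (c * ell1_norm w)"
    by (simp add: algebra_simps)
  also have "\<dots> \<le> ell1_norm w - e * (ell1_norm R - (\<Sum>\<^sub>\<infinity>i\<in>{1..}. v i * \<bar>w i\<bar>))"
    using mult_left_mono[OF RV e] by simp
  also have "\<dots> = (\<Sum>\<^sub>\<infinity>i\<in>{1..}. \<bar>w i\<bar> - e * (\<bar>R i\<bar> - v i * \<bar>w i\<bar>))"
    using w Rs vw
    by (simp add: infsum_diff summable_on_diff summable_on_cmult_right infsum_cmult_right' ell1_norm_def)
  also have "\<dots> \<le> ell1_norm (\<lambda>i. w i - e * (R i - v i * w i))"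
    unfolding ell1_norm_def
  proof (intro infsum_mono sum summable_on_diff summable_on_cmult_right w Rs vw)
    fix i :: nat assume "i \<in> {1..}"
    then have "\<bar>w i * (1 + e * v i)\<bar> = \<bar>w i\<bar> * (1 + e * v i)" "\<bar>e * R i\<bar> = e * \<bar>R i\<bar>"
      using v e by (auto simp: abs_mult)
    moreover have "w i - e * (R i - v i * w i) = w i * (1 + e * v i) - e * R i"
      by (simp add: algebra_simps)
    ultimately show "\<bar>w i\<bar> - e * (\<bar>R i\<bar> - v i * \<bar>w i\<bar>) \<le> \<bar>w i - e * (R i - v i * w i)\<bar>"
      using abs_triangle_ineq2[of "w i * (1 + e * v i)" "e * R i"] by (simp add: algebra_simps)
  qed
  finally show ?thesis .
qed

section \<open>Difference estimate for the interaction operator\<close>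

context
  fixes h D :: real and \<alpha> \<beta> :: "nat \<Rightarrow> real" and u f g :: "nat \<Rightarrow> real"
  assumes h: "0 < h" and D: "0 \<le> D" and u: "\<And>i. i \<ge> 1 \<Longrightarrow> 0 \<le> u i"
    and f: "\<And>i. i \<ge> 1 \<Longrightarrow> 0 \<le> f i" and g: "\<And>i. i \<ge> 1 \<Longrightarrow> 0 \<le> g i"
    and uf: "(\<lambda>i. u i * f i) summable_on {1..}" and ug: "(\<lambda>i. u i * g i) summable_on {1..}"
begin

text \<open>The bound of \<open>fiber_form_diff\<close>, named so that the contributions of the
  fibre forms can be counted as multiples of it.\<close>

definition pair_bound :: real
  where "pair_bound = D * ((\<Sum>\<^sub>\<infinity>i\<in>{1..}. u i * \<bar>f i - g i\<bar>) * (\<Sum>\<^sub>\<infinity>i\<in>{1..}. u i * (f i + g i)))"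

lemma fiber_form_ell1_le:
  assumes "P \<subseteq> {1..} \<times> {1..}" "p ` P \<subseteq> {1..}"
    and "\<And>a b. (a, b) \<in> P \<Longrightarrow> 0 \<le> k (a, b)" "\<And>a b. (a, b) \<in> P \<Longrightarrow> k (a, b) \<le> D * (u a * u b)"
  shows "ell1_le (\<lambda>i. fiber_form P p k f i - fiber_form P p k g i) pair_bound"
  using fiber_form_diff[OF assms(1,2) _ _ D u f g uf ug, of k] assms(3,4)
  by (auto simp: ell1_le_def ell1_norm_def pair_bound_def)

text \<open>The gain form has weight 1 and the loss form weight 2, hence the factor 3.\<close>

lemma S_one_ell1_le:
  assumes K: "\<And>a b. a \<ge> 1 \<Longrightarrow> b \<ge> 1 \<Longrightarrow> kern \<alpha> \<beta> 1 (real a * h) (real b * h) \<le> D * (u a * u b)"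
  shows "ell1_le (\<lambda>i. S_one h \<alpha> \<beta> f i - S_one h \<alpha> \<beta> g i) (3 * pair_bound)"
proof -
  let ?P = "{1..} \<times> {1..} :: (nat \<times> nat) set"
  let ?k = "\<lambda>(a, b). kern \<alpha> \<beta> 1 (real a * h) (real b * h)"
  let ?d = "\<lambda>p i. fiber_form ?P p ?k f i - fiber_form ?P p ?k g i"
  have "ell1_le (?d p) pair_bound" if "p ` ?P \<subseteq> {1..}" for p
    using that h K by (intro fiber_form_ell1_le) (auto intro: kern_nonneg)
  then have "ell1_le (?d (\<lambda>(a, b). a + b)) pair_bound" "ell1_le (?d fst) pair_bound"
    by (simp_all add: image_subset_iff split_beta)
  then have "ell1_le (\<lambda>i. ?d (\<lambda>(a, b). a + b) i + (- 2) * ?d fst i) (pair_bound + \<bar>- 2\<bar> * pair_bound)"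
    by (intro ell1_le_add ell1_le_cmult)
  then have "ell1_le (\<lambda>i. ?d (\<lambda>(a, b). a + b) i + (- 2) * ?d fst i) (3 * pair_bound)"
    by simp
  then show ?thesis
    by (rule ell1_le_cong) (simp add: S_one_fiber_form)
qed

lemma S_ex_ell1_le:
  assumes K: "\<And>a b. a \<ge> 1 \<Longrightarrow> b \<ge> 1 \<Longrightarrow> kern \<alpha> \<beta> n (real a * h) (real b * h) \<le> D * (u a * u b)"
    and n: "0 \<le> \<alpha> n" "0 \<le> \<beta> n"
  shows "ell1_le (\<lambda>i. S_ex h \<alpha> \<beta> n f i - S_ex h \<alpha> \<beta> n g i) (3 * pair_bound)"
proof -
  let ?P = "{(a, b). 1 \<le> b \<and> b < a} :: (nat \<times> nat) set"
  let ?Q = "{(a, b). 1 \<le> a \<and> a < b} :: (nat \<times> nat) set"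
  let ?k = "\<lambda>(a, b). kern \<alpha> \<beta> n (real (a - b) * h) (real b * h)"
  let ?l = "\<lambda>(a, b). kern \<alpha> \<beta> n (real (b - a) * h) (real a * h)"
  have diff: "kern \<alpha> \<beta> n (real (a - b) * h) (real b * h) \<le> D * (u a * u b)" if "1 \<le> b" "b < a" for a b
  proof -
    have "real (a - b) * h = real a * h - real b * h"
      using that by (simp add: of_nat_diff left_diff_distrib)
    then have "kern \<alpha> \<beta> n (real (a - b) * h) (real b * h) \<le> kern \<alpha> \<beta> n (real a * h) (real b * h)"
      using kern_diff_le[of "real b * h" "real a * h" \<alpha> n \<beta>] that h n by simp
    also have "\<dots> \<le> D * (u a * u b)" using K that by simp
    finally show ?thesis .
  qed
  let ?d = "\<lambda>p i. fiber_form ?P p ?k f i - fiber_form ?P p ?k g i"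
  let ?e = "\<lambda>i. fiber_form ?Q fst ?l f i - fiber_form ?Q fst ?l g i"
  have d': "ell1_le (?d p) pair_bound" if "p ` ?P \<subseteq> {1..}" for p
    using that h diff by (intro fiber_form_ell1_le) (auto intro: kern_nonneg)
  have d: "ell1_le (?d fst) pair_bound" "ell1_le (?d (\<lambda>(a, b). a - b)) pair_bound"
    by (rule d'; auto)+
  \<comment> \<open>Here the first index is the smaller one, so \<open>diff\<close> is applied with
    the indices exchanged.\<close>
  have "?l (a, b) \<le> D * (u a * u b)" if "(a, b) \<in> ?Q" for a b
    using diff[of a b] diff[of b a] that by (simp add: mult.commute)
  then have e: "ell1_le ?e pair_bound"
    using h by (intro fiber_form_ell1_le) (auto intro: kern_nonneg)
  have "ell1_le (\<lambda>i. (- 1) * ?d fst i + ?e i + ?d (\<lambda>(a, b). a - b) i)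
      (\<bar>- 1\<bar> * pair_bound + pair_bound + pair_bound)"
    by (intro ell1_le_add ell1_le_cmult d e)
  then have "ell1_le (\<lambda>i. (- 1) * ?d fst i + ?e i + ?d (\<lambda>(a, b). a - b) i) (3 * pair_bound)"
    by simp
  then show ?thesis
    by (rule ell1_le_cong) (simp add: S_ex_fiber_form)
qed

lemma interaction_ell1_le:
  assumes K: "\<And>n a b. n \<in> {1, 2, 3} \<Longrightarrow> a \<ge> 1 \<Longrightarrow> b \<ge> 1
      \<Longrightarrow> kern \<alpha> \<beta> n (real a * h) (real b * h) \<le> D * (u a * u b)"
    and n: "\<And>n. n \<in> {1, 2, 3} \<Longrightarrow> 0 \<le> \<alpha> n \<and> 0 \<le> \<beta> n"
  shows "ell1_le (\<lambda>i. (S_one h \<alpha> \<beta> f i + S_ex h \<alpha> \<beta> 2 f i + S_ex h \<alpha> \<beta> 3 f i)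
      - (S_one h \<alpha> \<beta> g i + S_ex h \<alpha> \<beta> 2 g i + S_ex h \<alpha> \<beta> 3 g i)) (9 * pair_bound)"
proof -
  have "ell1_le (\<lambda>i. (S_one h \<alpha> \<beta> f i - S_one h \<alpha> \<beta> g i) + (S_ex h \<alpha> \<beta> 2 f i - S_ex h \<alpha> \<beta> 2 g i)
      + (S_ex h \<alpha> \<beta> 3 f i - S_ex h \<alpha> \<beta> 3 g i)) (3 * pair_bound + 3 * pair_bound + 3 * pair_bound)"
    using K n by (intro ell1_le_add S_one_ell1_le S_ex_ell1_le) auto
  then have "ell1_le (\<lambda>i. (S_one h \<alpha> \<beta> f i - S_one h \<alpha> \<beta> g i) + (S_ex h \<alpha> \<beta> 2 f i - S_ex h \<alpha> \<beta> 2 g i)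
      + (S_ex h \<alpha> \<beta> 3 f i - S_ex h \<alpha> \<beta> 3 g i)) (9 * pair_bound)"
    by simp
  then show ?thesis
    by (rule ell1_le_cong) simp
qed

end

section \<open>Backward estimate for the full operator\<close>

lemma ex_kern_bound:
  assumes "h > 0" and "\<forall>n\<in>{1, 2, 3}. \<alpha> n > 0 \<and> \<beta> n > 0"
  defines "s \<equiv> MAX n\<in>{1, 2, 3}. \<alpha> n + \<beta> n"
  shows "\<exists>D\<ge>0. \<forall>n\<in>{1, 2, 3}. \<forall>a\<ge>1. \<forall>b\<ge>1.
    kern \<alpha> \<beta> n (real a * h) (real b * h) \<le> D * ((real a * h) powr s * (real b * h) powr s)"
proof (intro exI conjI ballI allI impI)
  \<comment> \<open>These are the constants of \<open>kern_le\<close>; being nonnegative, each is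
    dominated by their sum, which serves as a common \<open>D\<close>.\<close>
  let ?c = "\<lambda>n::nat. (2 / h) powr \<beta> n * h powr (2 * (\<alpha> n + \<beta> n - s))"
  show "0 \<le> sum ?c {1, 2, 3}" by (intro sum_nonneg) auto
  fix n a b :: nat assume n: "n \<in> {1, 2, 3}" and ab: "a \<ge> 1" "b \<ge> 1"
  have "\<alpha> n + \<beta> n \<le> s" unfolding s_def using n by (intro Max_ge) auto
  then have "kern \<alpha> \<beta> n (real a * h) (real b * h) \<le> ?c n * ((real a * h) powr s * (real b * h) powr s)"
    using assms(1,2) n ab by (intro kern_le) (auto intro: less_imp_le)
  also have "?c n \<le> sum ?c {1, 2, 3}" using n by (intro member_le_sum) auto
  finally show "kern \<alpha> \<beta> n (real a * h) (real b * h)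
      \<le> sum ?c {1, 2, 3} * ((real a * h) powr s * (real b * h) powr s)"
    by (simp add: mult_right_mono)
qed

lemma lower_moment:
  assumes h: "0 < h" and s: "s \<le> \<kappa>" and x: "\<And>i. i \<ge> 1 \<Longrightarrow> 0 \<le> x i" and m: "finite_moment h \<kappa> x"
  shows "(\<lambda>i. (real i * h) powr s * x i) summable_on {1..}"
    and "(\<Sum>\<^sub>\<infinity>i\<in>{1..}. (real i * h) powr s * x i) \<le> h powr (s - \<kappa>) * moment h \<kappa> x"
proof -
  have *: "(real i * h) powr s * x i \<le> h powr (s - \<kappa>) * (x i * (real i * h) powr \<kappa>)"
    if "i \<in> {1..}" for i
    using mult_right_mono[OF powr_le_rescale[of h "real i * h" s \<kappa>] x[of i]] h s that
    by (simp add: ac_simps)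
  have sm: "(\<lambda>i. h powr (s - \<kappa>) * (x i * (real i * h) powr \<kappa>)) summable_on {1..}"
    using m unfolding finite_moment_def by (rule summable_on_cmult_right)
  show sx: "(\<lambda>i. (real i * h) powr s * x i) summable_on {1..}"
    by (rule summable_on_comparison_test[OF sm *]) (use x in auto)
  show "(\<Sum>\<^sub>\<infinity>i\<in>{1..}. (real i * h) powr s * x i) \<le> h powr (s - \<kappa>) * moment h \<kappa> x"
    using infsum_mono[OF sx sm *] by (simp add: moment_def infsum_cmult_right')
qed

text \<open>This is the backward estimate required by \<open>norm_growth_bound\<close>, with a
  constant that depends on the two states only through the bound \<open>M\<close> on their
  \<kappa>-moments.\<close>

lemma O_op_dissipation:
  fixes f g F G :: ell1
  assumes h: "h > 0" and exps: "\<forall>n\<in>{1, 2, 3}. \<alpha> n > 0 \<and> \<beta> n > 0"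
    and D: "D \<ge> 0" and K: "\<forall>n\<in>{1, 2, 3}. \<forall>a\<ge>1. \<forall>b\<ge>1.
      kern \<alpha> \<beta> n (real a * h) (real b * h) \<le> D * ((real a * h) powr s * (real b * h) powr s)"
    and s: "0 < s" "s < \<delta>" "\<delta> \<le> \<kappa>"
    and f: "\<And>i. i \<ge> 1 \<Longrightarrow> 0 \<le> coord f i" "finite_moment h \<kappa> (coord f)" "moment h \<kappa> (coord f) \<le> M"
    and g: "\<And>i. i \<ge> 1 \<Longrightarrow> 0 \<le> coord g i" "finite_moment h \<kappa> (coord g)" "moment h \<kappa> (coord g) \<le> M"
    and F: "\<And>i. i \<ge> 1 \<Longrightarrow> coord F i = O_op h \<alpha> \<beta> \<delta> (coord f) i"
    and G: "\<And>i. i \<ge> 1 \<Longrightarrow> coord G i = O_op h \<alpha> \<beta> \<delta> (coord g) i"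
    and e: "e \<ge> 0"
  shows "norm (f - g) * (1 - e * (18 * D * h powr (s - \<kappa>) * M) powr (\<delta> / (\<delta> - s)))
    \<le> norm ((f - g) - e *\<^sub>R (F - G))"
proof -
  define u where "u = (\<lambda>i. (real i * h) powr s)"
  define v where "v = (\<lambda>i. (real i * h) powr \<delta>)"
  \<comment> \<open>The factor 18 is the total weight 9 of the fibre forms times 2, since the
    weighted sum of \<open>coord f + coord g\<close> costs one moment bound for each state.\<close>
  define y where "y = 18 * D * h powr (s - \<kappa>) * M"
  define w where "w = (\<lambda>i. coord f i - coord g i)"
  define J where "J = (\<lambda>x i. S_one h \<alpha> \<beta> x i + S_ex h \<alpha> \<beta> 2 x i + S_ex h \<alpha> \<beta> 3 x i)"
  define R where "R = (\<lambda>i. J (coord f) i - J (coord g) i)"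
  have low: "(\<lambda>i. (real i * h) powr p * coord x i) summable_on {1..}"
    if "p \<le> \<kappa>" "x \<in> {f, g}" for p x
    using lower_moment(1)[OF h that(1)] that(2) f g by auto
  have pw: "(\<lambda>i. (real i * h) powr p * \<bar>w i\<bar>) summable_on {1..}" if "p \<le> \<kappa>" for p
    unfolding w_def by (intro weighted_diff_summable(2) low that f g) auto
  have us: "(\<lambda>i. u i * coord f i) summable_on {1..}" "(\<lambda>i. u i * coord g i) summable_on {1..}"
    unfolding u_def using s by (intro low; simp)+
  have M0: "0 \<le> M"
  proof -
    have "0 \<le> moment h \<kappa> (coord f)"
      unfolding moment_def using f(1) by (intro infsum_nonneg) auto
    with f(3) show ?thesis by simp
  qed
  then have y0: "0 \<le> y" using D by (simp add: y_def)
  have "(\<Sum>\<^sub>\<infinity>i\<in>{1..}. u i * (coord f i + coord g i))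
      = (\<Sum>\<^sub>\<infinity>i\<in>{1..}. u i * coord f i) + (\<Sum>\<^sub>\<infinity>i\<in>{1..}. u i * coord g i)"
    using us by (simp add: distrib_left infsum_add)
  also have "\<dots> \<le> h powr (s - \<kappa>) * moment h \<kappa> (coord f) + h powr (s - \<kappa>) * moment h \<kappa> (coord g)"
    unfolding u_def using s by (intro add_mono lower_moment h f g) auto
  also have "\<dots> \<le> h powr (s - \<kappa>) * M + h powr (s - \<kappa>) * M"
    using f g by (intro add_mono mult_left_mono) auto
  finally have S: "(\<Sum>\<^sub>\<infinity>i\<in>{1..}. u i * (coord f i + coord g i)) \<le> 2 * h powr (s - \<kappa>) * M"
    by (simp add: ac_simps)
  have "ell1_le R (9 * (D * ((\<Sum>\<^sub>\<infinity>i\<in>{1..}. u i * \<bar>w i\<bar>) * (\<Sum>\<^sub>\<infinity>i\<in>{1..}. u i * (coord f i + coord g i)))))"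
    (is "ell1_le R ?B")
    using interaction_ell1_le[of h D u "coord f" "coord g" \<alpha> \<beta>] h D f(1) g(1) us K exps
    by (force simp: pair_bound_def R_def J_def w_def u_def)
  moreover have "?B \<le> y * (\<Sum>\<^sub>\<infinity>i\<in>{1..}. u i * \<bar>w i\<bar>)"
  proof -
    have "?B \<le> 9 * (D * ((\<Sum>\<^sub>\<infinity>i\<in>{1..}. u i * \<bar>w i\<bar>) * (2 * h powr (s - \<kappa>) * M)))"
      using D S by (intro mult_left_mono infsum_nonneg) (auto simp: u_def)
    then show ?thesis by (simp add: y_def ac_simps)
  qed
  ultimately have R: "ell1_le R (y * (\<Sum>\<^sub>\<infinity>i\<in>{1..}. u i * \<bar>w i\<bar>))"
    by (auto simp: ell1_le_def)
  have ws: "(\<lambda>i. \<bar>w i\<bar>) summable_on {1..}"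
    using coord[of "f - g"] by (simp add: minus_ell1.rep_eq w_def)
  have N: "norm (f - g) = ell1_norm w"
    by (simp add: norm_ell1.rep_eq minus_ell1.rep_eq w_def)
  have co: "coord ((f - g) - e *\<^sub>R (F - G)) i = w i - e * (R i - v i * w i)" if "i \<ge> 1" for i
    using that by (simp add: minus_ell1.rep_eq scaleR_ell1.rep_eq F G O_op_def V_op_def
        w_def R_def J_def v_def right_diff_distrib)
  have N': "norm ((f - g) - e *\<^sub>R (F - G)) = ell1_norm (\<lambda>i. w i - e * (R i - v i * w i))"
    unfolding norm_ell1.rep_eq ell1_norm_def using co by (intro infsum_cong) auto
  have sum: "(\<lambda>i. \<bar>w i - e * (R i - v i * w i)\<bar>) summable_on {1..}"
    using coord[of "(f - g) - e *\<^sub>R (F - G)"] co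
    by (subst summable_on_cong[where g = "\<lambda>i. \<bar>coord ((f - g) - e *\<^sub>R (F - G)) i\<bar>"]) auto
  show ?thesis
    unfolding N N' y_def[symmetric]
  proof (rule dissipation[OF ws _ _ R _ _ e sum])
    show "(\<lambda>i. u i * \<bar>w i\<bar>) summable_on {1..}" "(\<lambda>i. v i * \<bar>w i\<bar>) summable_on {1..}"
      unfolding u_def v_def using s by (intro pw; simp)+
    show "y * u i \<le> v i + y powr (\<delta> / (\<delta> - s))" "0 \<le> v i" for i
      unfolding u_def v_def using h s y0 by (auto intro: powr_absorb)
  qed
qed

section \<open>Data of a solution and the stability estimate\<close>

lemma is_solution_derivative:
  assumes "is_solution h \<alpha> \<beta> \<delta> \<kappa> f0 f"
  obtains F where "\<And>t. t \<ge> 0 \<Longrightarrow> (f has_vector_derivative F t) (at t within {0..})"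
    "\<And>t i. t \<ge> 0 \<Longrightarrow> i \<ge> 1 \<Longrightarrow> coord (F t) i = O_op h \<alpha> \<beta> \<delta> (coord (f t)) i"
proof -
  obtain F where "\<forall>t\<ge>0. (f has_vector_derivative F t) (at t within {0..}) \<and>
      (\<forall>i\<ge>1. coord (F t) i = O_op h \<alpha> \<beta> \<delta> (coord (f t)) i)"
    using assms unfolding is_solution_def by (elim conjE exE)
  then show ?thesis by (intro that[of F]) auto
qed

lemma is_solution_bounds:
  assumes "is_solution h \<alpha> \<beta> \<delta> \<kappa> f0 f" "t \<ge> 0" "i \<ge> 1"
  shows "0 \<le> coord (f t) i" "finite_moment h \<kappa> (coord (f t))"
    "moment h \<kappa> (coord (f t)) \<le> max (moment h \<kappa> f0) (2 * B_bound \<alpha> \<beta> \<delta> \<kappa> (moment h 1 f0))"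
  using assms unfolding is_solution_def by blast+

lemma is_solution_initial:
  "is_solution h \<alpha> \<beta> \<delta> \<kappa> f0 f \<Longrightarrow> i \<ge> 1 \<Longrightarrow> coord (f 0) i = f0 i"
  by (simp add: is_solution_def)

theorem theorem2p5:
  fixes h \<delta> \<kappa> :: real and \<alpha> \<beta> :: "nat \<Rightarrow> real"
  assumes "h > 0"
    and "\<forall>n\<in>{1, 2, 3}. \<alpha> n > 0 \<and> \<beta> n > 0"
    and "\<delta> > 0"
    and "\<delta> > (MAX n\<in>{1, 2, 3}. \<alpha> n + \<beta> n)"
    and "\<delta> > 2 * \<alpha> 1 + \<beta> 1 - 1"
    and "\<kappa> > Max {\<delta>, 1, 2 - \<alpha> 1 - \<beta> 1}"
  shows "\<exists>C :: real \<Rightarrow> real \<Rightarrow> real. (\<forall>a b. C a b > 0) \<and>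
    (\<forall>(f0 :: nat \<Rightarrow> real) (g0 :: nat \<Rightarrow> real) (f :: real \<Rightarrow> ell1) (g :: real \<Rightarrow> ell1).
      (\<forall>i\<ge>1. f0 i \<ge> 0) \<and> (\<forall>i\<ge>1. g0 i \<ge> 0) \<and>
      finite_moment h \<kappa> f0 \<and> finite_moment h \<kappa> g0 \<and>
      is_solution h \<alpha> \<beta> \<delta> \<kappa> f0 f \<and> is_solution h \<alpha> \<beta> \<delta> \<kappa> g0 g \<longrightarrow>
      (\<forall>t\<ge>0. norm (f t - g t)
        \<le> exp (C (max (moment h 1 f0) (moment h 1 g0))
                 (max (moment h \<kappa> f0) (moment h \<kappa> g0)) * t)
          * ell1_norm (\<lambda>i. f0 i - g0 i)))"
proof -
  define s where "s = (MAX n\<in>{1, 2, 3}. \<alpha> n + \<beta> n)"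
  have "\<alpha> 1 + \<beta> 1 \<le> s" unfolding s_def by (intro Max_ge) auto
  moreover have "0 < \<alpha> 1 + \<beta> 1" using assms(2) by (simp add: add_pos_pos)
  ultimately have s: "0 < s" "s < \<delta>" using assms(4) unfolding s_def by linarith+
  have \<kappa>: "\<delta> \<le> \<kappa>" "1 < \<kappa>" using assms(6) by auto
  obtain D where D: "D \<ge> 0" and K: "\<forall>n\<in>{1, 2, 3}. \<forall>a\<ge>1. \<forall>b\<ge>1.
      kern \<alpha> \<beta> n (real a * h) (real b * h) \<le> D * ((real a * h) powr s * (real b * h) powr s)"
    using ex_kern_bound[OF assms(1,2)] unfolding s_def by blast
  \<comment> \<open>A bound, uniform in time, for the \<kappa>-moments of both solutions, written as
    a function of the larger first moment \<open>a\<close> and the larger \<kappa>-moment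
    \<open>b\<close> of the data.\<close>
  define M where "M = (\<lambda>a b. max b (2 * B_bound \<alpha> \<beta> \<delta> \<kappa> a))"
  define c where "c = (\<lambda>a b. (18 * D * h powr (s - \<kappa>) * M a b) powr (\<delta> / (\<delta> - s)))"
  show ?thesis
  \<comment> \<open>Adding 1 makes the rate positive and strictly larger than \<open>c a b\<close>,
    as \<open>norm_growth_bound\<close> demands.\<close>
  proof (rule exI[of _ "\<lambda>a b. c a b + 1"], intro conjI allI impI)
    show "c a b + 1 > 0" for a b
      using powr_ge_zero by (simp add: c_def add_nonneg_pos)
    fix f0 g0 :: "nat \<Rightarrow> real" and f g :: "real \<Rightarrow> ell1" and t :: real
    let ?a = "max (moment h 1 f0) (moment h 1 g0)"
    let ?b = "max (moment h \<kappa> f0) (moment h \<kappa> g0)"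
    assume A: "(\<forall>i\<ge>1. f0 i \<ge> 0) \<and> (\<forall>i\<ge>1. g0 i \<ge> 0) \<and>
      finite_moment h \<kappa> f0 \<and> finite_moment h \<kappa> g0 \<and>
      is_solution h \<alpha> \<beta> \<delta> \<kappa> f0 f \<and> is_solution h \<alpha> \<beta> \<delta> \<kappa> g0 g" and t: "t \<ge> 0"
    have M: "max (moment h \<kappa> x) (2 * B_bound \<alpha> \<beta> \<delta> \<kappa> (moment h 1 x)) \<le> M ?a ?b"
      if "x \<in> {f0, g0}" for x
    proof -
      have "0 \<le> moment h 1 x"
        unfolding moment_def using A that by (intro infsum_nonneg) auto
      then have "B_bound \<alpha> \<beta> \<delta> \<kappa> (moment h 1 x) \<le> B_bound \<alpha> \<beta> \<delta> \<kappa> ?a"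
        using that \<kappa> assms(3,5) by (intro B_bound_mono) auto
      then show ?thesis using that by (auto simp: M_def)
    qed
    from A have sol: "is_solution h \<alpha> \<beta> \<delta> \<kappa> f0 f" "is_solution h \<alpha> \<beta> \<delta> \<kappa> g0 g" by auto
    obtain F where
      F: "\<And>t. t \<ge> 0 \<Longrightarrow> (f has_vector_derivative F t) (at t within {0..})"
        "\<And>t i. t \<ge> 0 \<Longrightarrow> i \<ge> 1 \<Longrightarrow> coord (F t) i = O_op h \<alpha> \<beta> \<delta> (coord (f t)) i"
      by (rule is_solution_derivative[OF sol(1)]) blast
    obtain G where
      G: "\<And>t. t \<ge> 0 \<Longrightarrow> (g has_vector_derivative G t) (at t within {0..})"
        "\<And>t i. t \<ge> 0 \<Longrightarrow> i \<ge> 1 \<Longrightarrow> coord (G t) i = O_op h \<alpha> \<beta> \<delta> (coord (g t)) i"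
      by (rule is_solution_derivative[OF sol(2)]) blast
    have f: "0 \<le> coord (f t) i" "finite_moment h \<kappa> (coord (f t))" "moment h \<kappa> (coord (f t)) \<le> M ?a ?b"
      and g: "0 \<le> coord (g t) i" "finite_moment h \<kappa> (coord (g t))" "moment h \<kappa> (coord (g t)) \<le> M ?a ?b"
      if "t \<ge> 0" "i \<ge> 1" for t i
      using is_solution_bounds[OF sol(1) that] is_solution_bounds[OF sol(2) that]
        order_trans[OF _ M[of f0]] order_trans[OF _ M[of g0]]
      by auto
    have "norm (f t - g t) \<le> exp ((c ?a ?b + 1) * t) * norm (f 0 - g 0)"
    proof (rule norm_growth_bound[where w = "\<lambda>t. f t - g t" and W = "\<lambda>t. F t - G t" and C = "c ?a ?b"])
      \<comment> \<open>The moment facts in \<open>f\<close> and \<open>g\<close> do not involve the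
        index; instantiating it with \<open>1\<close> discharges their side condition.\<close>
      show "norm (f t - g t) * (1 - e * c ?a ?b) \<le> norm (f t - g t - e *\<^sub>R (F t - G t))"
        if "t \<ge> 0" "e \<ge> 0" for t e
        unfolding c_def
        using that f(1) g(1) f(2,3)[of t 1] g(2,3)[of t 1] F(2) G(2)
        by (intro O_op_dissipation[OF assms(1,2) D K s \<kappa>(1)]) auto
    qed (use F(1) G(1) t in \<open>auto simp: c_def intro: has_vector_derivative_diff\<close>)
    also have "norm (f 0 - g 0) = ell1_norm (\<lambda>i. f0 i - g0 i)"
      unfolding norm_ell1.rep_eq ell1_norm_def minus_ell1.rep_eq
      using is_solution_initial[OF sol(1)] is_solution_initial[OF sol(2)]
      by (intro infsum_cong) auto
    finally show "norm (f t - g t) \<le> exp ((c ?a ?b + 1) * t) * ell1_norm (\<lambda>i. f0 i - g0 i)" .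
  qed
qed

end
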